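(* Let $n \ge 3$ be an integer and let $1 \le i \le \tau = \lfloor \frac{n}{2} \rfloor$. Then the graph $C_n^i$ is singular if and only if $n$ is a multiple of $4$ and $\gcd\left(i, \frac{n}{2}\right)$ divides $\frac{n}{4}$.
   Context: A graph is called singular if its adjacency matrix is singular. $C_n$ denotes the cycle graph on $n$ vertices. For $1 \le i \le \lfloor n/2 \rfloor$, $C_n^i$ is the graph on the vertex set of $C_n$ in which two vertices are adjacent exactly when their distance in $C_n$ equals $i$ (so $C_n^1 = C_n$). *)

theory Defs
  imports
    "Graph_Theory.Pair_Digraph"
    "Graph_Theory.Shortest_Path"
    "Jordan_Normal_Form.Matrix"
begin

text \<open>
  Simple graphs are finite, loop-free, symmetric digraphs without parallel arcs (locale
  \<^locale>\<open>pair_graph\<close>): an edge is represented by its two arcs.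
\<close>

definition cycle_graph :: "nat \<Rightarrow> nat pair_pre_digraph" where
  "cycle_graph n =
     \<lparr> pverts = {..<n},
       parcs = {(u, v). u < n \<and> v < n \<and> (v = Suc u mod n \<or> u = Suc v mod n)} \<rparr>"

definition graph_dist :: "'a pair_pre_digraph \<Rightarrow> 'a \<Rightarrow> 'a \<Rightarrow> ereal" where
  "graph_dist G = wf_digraph.\<mu> (with_proj G) (\<lambda>_. 1)"

definition distance_graph :: "'a pair_pre_digraph \<Rightarrow> nat \<Rightarrow> 'a pair_pre_digraph" where
  "distance_graph G i =
     \<lparr> pverts = pverts G,
       parcs = {(u, v). u \<in> pverts G \<and> v \<in> pverts G \<and> graph_dist G u v = ereal (real i)} \<rparr>"

text \<open>Rows and columns follow the increasing enumeration of the (finite) vertex set.\<close>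

definition adjacency_matrix :: "'a::linorder pair_pre_digraph \<Rightarrow> real mat" where
  "adjacency_matrix G =
     (let vs = sorted_list_of_set (pverts G)
      in mat (length vs) (length vs) (\<lambda>(a, b). if (vs ! a, vs ! b) \<in> parcs G then 1 else 0))"

definition singular_graph :: "'a::linorder pair_pre_digraph \<Rightarrow> bool" where
  "singular_graph G \<longleftrightarrow> \<not> invertible_mat (adjacency_matrix G)"

lemma pair_graph_cycle_graph:
  assumes "n \<ge> 3"
  shows "pair_graph (cycle_graph n)"
proof
  have "parcs (cycle_graph n) \<subseteq> {..<n} \<times> {..<n}"
    by (auto simp: cycle_graph_def)
  then show "finite (parcs (cycle_graph n))"
    by (rule finite_subset) simp
qed (use assms in \<open>auto simp: cycle_graph_def symmetric_def mod_Suc intro!: symI split: if_splits\<close>)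

lemma graph_dist_eq:
  assumes "pair_wf_digraph G"
  shows "graph_dist G u v = (INF p \<in> {p. pre_digraph.awalk (with_proj G) u p v}. ereal (real (length p)))"
proof -
  interpret pair_wf_digraph G by fact
  have "awalk_cost (\<lambda>_. 1) p = real (length p)" for p :: "('a \<times> 'a) list"
    by (induction p) (auto simp: awalk_cost_def)
  then show ?thesis
    by (simp add: graph_dist_def \<mu>_def)
qed

end

theory Submission
  imports Defs "Jordan_Normal_Form.Determinant" "HOL-Number_Theory.Cong"
begin

text \<open>
  A kernel vector of the adjacency matrix, read as an \<open>n\<close>-periodic function \<open>y\<close> on the integers, satisfies
  \<open>y (t + i) + y (t - i) = 0\<close> (for \<open>2 * i = n\<close> both neighbours coincide and the graph is a perfect
  matching, hence nonsingular). Thus translation by \<open>2 * i\<close> negates \<open>y\<close>; since this translation has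
  order \<open>n / gcd(n, 2 * i)\<close> modulo \<open>n\<close>, a nonzero \<open>y\<close> forces that order to be even, which is the stated
  divisibility condition. Conversely, with \<open>g = gcd(i, n / 2)\<close> the condition makes \<open>i / g\<close> odd and
  \<open>4 * g\<close> a divisor of \<open>n\<close>, so \<open>y t = cos (pi * t / (2 * g))\<close> is such a function.
\<close>

section \<open>Singularity expressed by kernel vectors\<close>

lemma not_invertible_mat_iff_kernel:
  fixes A :: "'a::field mat"
  assumes A: "A \<in> carrier_mat n n"
  shows "\<not> invertible_mat A \<longleftrightarrow> (\<exists>v \<in> carrier_vec n. v \<noteq> 0\<^sub>v n \<and> A *\<^sub>v v = 0\<^sub>v n)"
proof -
  have "invertible_mat A \<longleftrightarrow> det A \<noteq> 0"
  proof
    assume "invertible_mat A"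
    then obtain B where AB: "A * B = 1\<^sub>m n" and BA: "B * A = 1\<^sub>m (dim_row B)"
      using A by (auto simp: invertible_mat_def inverts_mat_def)
    \<comment> \<open>The definition of invertibility leaves the shape of \<open>B\<close> open;
      comparing column counts in \<open>A * B\<close> and \<open>B * A\<close> fixes it.\<close>
    have "B \<in> carrier_mat n n"
      using A arg_cong[OF AB, of dim_col] arg_cong[OF BA, of dim_col] by auto
    with A have "det A * det B = 1"
      using AB by (metis det_mult det_one)
    then show "det A \<noteq> 0" by auto
  next
    assume "det A \<noteq> 0"
    from det_non_zero_imp_unit[OF A this, where b = "()"]
    obtain B where "B \<in> carrier_mat n n" "B * A = 1\<^sub>m n" "A * B = 1\<^sub>m n"
      by (auto simp: Units_def ring_mat_simps)
    with A show "invertible_mat A"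
      by (auto simp: invertible_mat_def inverts_mat_def)
  qed
  then show ?thesis
    using det_0_iff_vec_prod_zero_field[OF A] by blast
qed

text \<open>The sorted enumeration of \<open>{..<n}\<close> is the identity, so each vertex is its
  own matrix index. Summing over a set counts coinciding neighbours once, which matters when
  \<open>2 * i = n\<close>.\<close>

lemma singular_graph_iff_kernel:
  assumes "pverts G = {..<n}"
  shows "singular_graph G \<longleftrightarrow>
    (\<exists>v :: real vec. v \<in> carrier_vec n \<and> v \<noteq> 0\<^sub>v n \<and> (\<forall>a<n. (\<Sum>b | b < n \<and> (a, b) \<in> parcs G. v $ b) = 0))"
proof -
  let ?A = "adjacency_matrix G"
  have A_eq: "?A = mat n n (\<lambda>(a, b). if (a, b) \<in> parcs G then 1 else 0)"
    using assms by (auto simp: adjacency_matrix_def Let_def atLeast0LessThan[symmetric] intro!: eq_matI)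
  then have A: "?A \<in> carrier_mat n n"
    by simp
  have row: "(?A *\<^sub>v v) $ a = (\<Sum>b | b < n \<and> (a, b) \<in> parcs G. v $ b)"
    if "v \<in> carrier_vec n" "a < n" for v a
  proof -
    have "(?A *\<^sub>v v) $ a = (\<Sum>b<n. (if (a, b) \<in> parcs G then 1 else 0) * v $ b)"
      using that by (simp add: A_eq scalar_prod_def atLeast0LessThan)
    also have "\<dots> = (\<Sum>b<n. if (a, b) \<in> parcs G then v $ b else 0)"
      by (rule sum.cong) auto
    also have "\<dots> = (\<Sum>b | b < n \<and> (a, b) \<in> parcs G. v $ b)"
      by (simp add: sum.inter_filter[symmetric])
    finally show ?thesis .
  qed
  have kernel: "?A *\<^sub>v v = 0\<^sub>v n \<longleftrightarrow> (\<forall>a<n. (\<Sum>b | b < n \<and> (a, b) \<in> parcs G. v $ b) = 0)"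
    if "v \<in> carrier_vec n" for v
    using that A row by (auto simp: vec_eq_iff)
  show ?thesis
    unfolding singular_graph_def not_invertible_mat_iff_kernel[OF A]
    using kernel by blast
qed

section \<open>Distances in the cycle as displacements modulo \<open>n\<close>\<close>

lemma graph_dist_eq_nat_iff:
  assumes "pair_wf_digraph G"
  shows "graph_dist G u v = ereal (real k) \<longleftrightarrow>
    (\<exists>p. pre_digraph.awalk (with_proj G) u p v \<and> length p = k) \<and>
    (\<forall>p. pre_digraph.awalk (with_proj G) u p v \<longrightarrow> k \<le> length p)" (is "?l \<longleftrightarrow> ?r")
proof
  assume l: ?l
  have ge: "k \<le> length p" if "pre_digraph.awalk (with_proj G) u p v" for p
  proof -
    have "graph_dist G u v \<le> ereal (real (length p))"
      unfolding graph_dist_eq[OF assms] using that by (auto intro: INF_lower)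
    with l show ?thesis by simp
  qed
  \<comment> \<open>The infimum is attained because lengths are integers: some walk is shorter than
    \<open>k + 1\<close>, and none is shorter than \<open>k\<close>.\<close>
  have "graph_dist G u v < ereal (real (Suc k))"
    using l by simp
  then obtain p where "pre_digraph.awalk (with_proj G) u p v" "length p < Suc k"
    unfolding graph_dist_eq[OF assms] INF_less_iff by auto
  with ge show ?r
    by (metis less_Suc_eq_le le_antisym)
next
  assume ?r
  then show ?l
    unfolding graph_dist_eq[OF assms] by (intro antisym INF_greatest) (auto intro: INF_lower2)
qed

text \<open>Integer congruences turn the two directions into displacements \<open>1\<close> and
  \<open>-1\<close>, which can be added along a walk.\<close>

lemma cycle_graph_arc_iff:
  "(u, v) \<in> parcs (cycle_graph n) \<longleftrightarrow> u < n \<and> v < n \<and>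
    ([int v = int u + 1] (mod int n) \<or> [int v = int u - 1] (mod int n))"
proof -
  have *: "y = Suc x mod n \<longleftrightarrow> [int y = int x + 1] (mod int n)" if "y < n" for x y
    using that cong_int_iff[of y "Suc x" n] by (simp add: cong_def add.commute)
  have "[int u = int v + 1] (mod int n) \<longleftrightarrow> [int v = int u - 1] (mod int n)"
    by (metis cong_sym_eq cong_add_rcancel diff_add_cancel)
  moreover have "(u, v) \<in> parcs (cycle_graph n) \<longleftrightarrow>
      u < n \<and> v < n \<and> (v = Suc u mod n \<or> u = Suc v mod n)"
    by (simp add: cycle_graph_def)
  ultimately show ?thesis
    using *[of v u] *[of u v] by argo
qed

text \<open>Each arc contributes \<open>1\<close> or \<open>-1\<close> to \<open>s\<close>. This
  bounds walk lengths from below.\<close>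

lemma cycle_graph_awalk_displacement:
  assumes "n \<ge> 3" and "pre_digraph.awalk (with_proj (cycle_graph n)) u p v"
  shows "\<exists>s. \<bar>s\<bar> \<le> int (length p) \<and> [int v = int u + s] (mod int n)"
proof -
  interpret pair_graph "cycle_graph n"
    by (rule pair_graph_cycle_graph) fact
  from assms(2) show ?thesis
  proof (induction p arbitrary: u)
    case Nil
    then show ?case by (auto simp: awalk_Nil_iff)
  next
    case (Cons e p)
    obtain w where e: "e = (u, w)" "(u, w) \<in> parcs (cycle_graph n)" and w: "awalk w p v"
      using Cons.prems by (cases e) (auto simp: awalk_Cons_iff)
    from Cons.IH[OF w] obtain s where s: "\<bar>s\<bar> \<le> int (length p)" "[int v = int w + s] (mod int n)"
      by blast
    from e(2) obtain d where d: "\<bar>d\<bar> = 1" "[int w = int u + d] (mod int n)"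
      unfolding cycle_graph_arc_iff by (metis abs_1 abs_minus diff_conv_add_uminus)
    have "[int v = int u + (d + s)] (mod int n)"
      using s(2) cong_add[OF d(2) cong_refl[of s]] by (simp add: cong_trans add.assoc)
    with s(1) d(1) show ?case
      by (intro exI[of _ "d + s"]) auto
  qed
qed

text \<open>The walk takes \<open>k\<close> steps in the fixed direction \<open>d\<close>. This
  bounds distances from above.\<close>

lemma cycle_graph_awalk_exists:
  assumes "n \<ge> 3" and "u < n" and "v < n" and "\<bar>d\<bar> = 1"
    and "[int v = int u + d * int k] (mod int n)"
  shows "\<exists>p. pre_digraph.awalk (with_proj (cycle_graph n)) u p v \<and> length p = k"
proof -
  interpret pair_graph "cycle_graph n"
    by (rule pair_graph_cycle_graph) fact
  from assms(2,5) show ?thesis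
  proof (induction k arbitrary: u)
    case 0
    then have "u = v"
      using assms(3) by (auto simp: cong_def)
    with assms(3) show ?case
      by (intro exI[of _ "[]"]) (simp add: awalk_Nil_iff, simp add: cycle_graph_def)
  next
    case (Suc k)
    define w where "w = nat ((int u + d) mod int n)"
    have "int w = (int u + d) mod int n"
      using assms(1) by (simp add: w_def)
    then have w: "w < n" "[int w = int u + d] (mod int n)"
      using assms(1) by (auto simp: cong_def w_def nat_less_iff)
    have "[int v = int w + d * int k] (mod int n)"
      using Suc.prems(2) cong_add[OF cong_sym[OF w(2)] cong_refl[of "d * int k"]]
      by (simp add: algebra_simps cong_trans)
    from Suc.IH[OF w(1) this] obtain p where p: "awalk w p v" "length p = k"
      by blast
    have "d = 1 \<or> d = -1"
      using assms(4) by auto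
    then have "(u, w) \<in> parcs (cycle_graph n)"
      using w Suc.prems(1) by (auto simp: cycle_graph_arc_iff)
    with p show ?case
      by (intro exI[of _ "(u, w) # p"]) (auto simp: awalk_Cons_iff)
  qed
qed

lemma distance_graph_cycle_graph_arc_iff:
  assumes "n \<ge> 3" and "1 \<le> i" and "i \<le> n div 2"
  shows "(u, v) \<in> parcs (distance_graph (cycle_graph n) i) \<longleftrightarrow> u < n \<and> v < n \<and>
    ([int v = int u + int i] (mod int n) \<or> [int v = int u - int i] (mod int n))"
proof -
  interpret pair_graph "cycle_graph n"
    by (rule pair_graph_cycle_graph) fact
  have wf: "pair_wf_digraph (cycle_graph n)"
    by unfold_locales
  have lower: "i \<le> length p"
    if p: "awalk u p v" and d: "\<bar>d\<bar> = 1" "[int v = int u + d * int i] (mod int n)" for p d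
  proof (rule ccontr)
    assume "\<not> i \<le> length p"
    obtain s where s: "\<bar>s\<bar> \<le> int (length p)" "[int v = int u + s] (mod int n)"
      using cycle_graph_awalk_displacement[OF assms(1) p] by blast
    have "[int u + d * int i = int u + s] (mod int n)"
      using s(2) d(2) by (metis cong_sym cong_trans)
    then have dvd: "int n dvd d * int i - s"
      by (simp add: cong_add_lcancel cong_iff_dvd_diff)
    have "\<bar>d * int i\<bar> = int i"
      using d(1) by (simp add: abs_mult)
    \<comment> \<open>Since \<open>s\<close> is smaller than \<open>i\<close> in absolute value, the
      difference is nonzero and of absolute value below \<open>2 * i\<close>, which is at most
      \<open>n\<close>.\<close>
    then have "d * int i - s \<noteq> 0" "\<bar>d * int i - s\<bar> < int n"
      using \<open>\<not> i \<le> length p\<close> s(1) assms(3) by linarith+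
    then show False
      using dvd dvd_imp_le_int[of "d * int i - s" "int n"] by simp
  qed
  have "graph_dist (cycle_graph n) u v = ereal (real i) \<longleftrightarrow>
      (\<exists>d. \<bar>d\<bar> = 1 \<and> [int v = int u + d * int i] (mod int n))" if "u < n" "v < n"
  proof
    assume "\<exists>d. \<bar>d\<bar> = 1 \<and> [int v = int u + d * int i] (mod int n)"
    then obtain d where d: "\<bar>d\<bar> = 1" "[int v = int u + d * int i] (mod int n)" by blast
    with lower cycle_graph_awalk_exists[OF assms(1) that d]
    show "graph_dist (cycle_graph n) u v = ereal (real i)"
      by (auto simp: graph_dist_eq_nat_iff[OF wf])
  next
    assume "graph_dist (cycle_graph n) u v = ereal (real i)"
    then obtain p where p: "awalk u p v" "length p = i" and min: "\<And>q. awalk u q v \<Longrightarrow> i \<le> length q"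
      by (auto simp: graph_dist_eq_nat_iff[OF wf])
    obtain s where s: "\<bar>s\<bar> \<le> int i" "[int v = int u + s] (mod int n)"
      using cycle_graph_awalk_displacement[OF assms(1) p(1)] p(2) by blast
    \<comment> \<open>Walking straight in the direction of \<open>s\<close> takes
      \<open>nat \<bar>s\<bar>\<close> steps, at most \<open>i\<close>; minimality of
      \<open>i\<close> forces equality.\<close>
    define d :: int where "d = (if s < 0 then -1 else 1)"
    have d: "\<bar>d\<bar> = 1" "s = d * int (nat \<bar>s\<bar>)"
      by (auto simp: d_def)
    obtain q where "awalk u q v" "length q = nat \<bar>s\<bar>"
      using cycle_graph_awalk_exists[OF assms(1) \<open>u < n\<close> \<open>v < n\<close> d(1)] s(2) d(2) by metis
    with min s(1) have "nat \<bar>s\<bar> = i" by fastforce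
    with s(2) d show "\<exists>d. \<bar>d\<bar> = 1 \<and> [int v = int u + d * int i] (mod int n)"
      by metis
  qed
  moreover have "(\<exists>d. \<bar>d\<bar> = 1 \<and> [int v = int u + d * int i] (mod int n)) \<longleftrightarrow>
      [int v = int u + int i] (mod int n) \<or> [int v = int u - int i] (mod int n)"
  proof -
    have "\<bar>d\<bar> = 1 \<longleftrightarrow> d = 1 \<or> d = -1" for d :: int by linarith
    then show ?thesis
      by (simp add: conj_disj_distribR ex_disj_distrib)
  qed
  ultimately show ?thesis
    by (simp add: distance_graph_def cycle_graph_def cong: conj_cong)
qed

text \<open>Vectors of length \<open>n\<close> correspond to \<open>n\<close>-periodic functions on
  the integers. The row sums have two terms exactly when \<open>2 * i \<noteq> n\<close>.\<close>

lemma singular_distance_graph_cycle_graph_iff: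
  assumes "n \<ge> 3" and "1 \<le> i" and "i \<le> n div 2"
  shows "singular_graph (distance_graph (cycle_graph n) i) \<longleftrightarrow>
    2 * i \<noteq> n \<and> (\<exists>y :: int \<Rightarrow> real. (\<exists>t. y t \<noteq> 0) \<and> (\<forall>t. y (t mod int n) = y t) \<and>
      (\<forall>t. y (t + int i) + y (t - int i) = 0))" (is "?l \<longleftrightarrow> ?r")
proof -
  \<comment> \<open>\<open>N t\<close> is the vector index representing the residue class of
    \<open>t\<close>.\<close>
  define N where "N t = nat (t mod int n)" for t
  have N: "N t < n" "int (N t) = t mod int n" "N (t mod int n) = N t" for t
    using assms(1) by (auto simp: N_def nat_less_iff)
  have N_less: "N (int a) = a" if "a < n" for a
    using that by (simp add: N_def)
  have N_add: "N (t mod int n + int i) = N (t + int i)"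
    and N_diff: "N (t mod int n - int i) = N (t - int i)" for t
    by (auto simp: N_def mod_simps)
  have N_eq: "[int b = t] (mod int n) \<longleftrightarrow> b = N t" if "b < n" for t b
    using that N[of t] by (auto simp: cong_def N_def)
  let ?G = "distance_graph (cycle_graph n) i"
  have nbrs: "{b. b < n \<and> (a, b) \<in> parcs ?G} = {N (int a + int i), N (int a - int i)}" if "a < n" for a
    using that N(1) by (auto simp: distance_graph_cycle_graph_arc_iff[OF assms] N_eq)
  \<comment> \<open>Coincidence means that \<open>n\<close> divides \<open>2 * i\<close>, and
    \<open>2 * i\<close> lies between \<open>1\<close> and \<open>n\<close>.\<close>
  have N_coincide: "N (t + int i) = N (t - int i) \<longleftrightarrow> 2 * i = n" for t
  proof -
    have "N (t + int i) = N (t - int i) \<longleftrightarrow> [t + int i = t - int i] (mod int n)"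
      using N(2) by (metis cong_def N_def)
    also have "\<dots> \<longleftrightarrow> n dvd 2 * i"
      using int_dvd_int_iff[of n "2 * i"] by (simp add: cong_iff_dvd_diff)
    also have "\<dots> \<longleftrightarrow> 2 * i = n"
      using assms by (auto dest: dvd_imp_le)
    finally show ?thesis .
  qed
  have singular_iff: "?l \<longleftrightarrow> (\<exists>v :: real vec. v \<in> carrier_vec n \<and> v \<noteq> 0\<^sub>v n \<and>
      (\<forall>a<n. (\<Sum>b \<in> {N (int a + int i), N (int a - int i)}. v $ b) = 0))"
  proof -
    have verts: "pverts ?G = {..<n}"
      by (simp add: distance_graph_def cycle_graph_def)
    show ?thesis
      unfolding singular_graph_iff_kernel[OF verts] using nbrs by simp
  qed
  show ?thesis
  proof
    assume ?l
    then obtain v :: "real vec" where v: "v \<in> carrier_vec n" "v \<noteq> 0\<^sub>v n"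
      and ker: "\<And>a. a < n \<Longrightarrow> (\<Sum>b \<in> {N (int a + int i), N (int a - int i)}. v $ b) = 0"
      unfolding singular_iff by blast
    obtain a where a: "a < n" "v $ a \<noteq> 0"
      using v by (auto simp: vec_eq_iff)
    have ker_int: "(\<Sum>b \<in> {N (t + int i), N (t - int i)}. v $ b) = 0" for t
      using ker[OF N(1)[of t]] by (simp only: N(2) N_add N_diff)
    \<comment> \<open>Otherwise every row sum is a single entry, so \<open>v\<close>
      vanishes.\<close>
    have "2 * i \<noteq> n"
    proof
      assume "2 * i = n"
      then have "v $ N (t + int i) = 0" for t
        using ker_int[of t] N_coincide[of t] by simp
      from this[of "int a - int i"] show False
        using a by (simp add: N_less)
    qed
    moreover have "v $ N (t + int i) + v $ N (t - int i) = 0" for t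
      using ker_int[of t] N_coincide[of t] \<open>2 * i \<noteq> n\<close> by simp
    ultimately show ?r
      using a by (intro conjI exI[of _ "\<lambda>t. v $ N t"] exI[of _ "int a"] allI)
        (auto simp: N_less N)
  next
    assume ?r
    then obtain y :: "int \<Rightarrow> real" and t where "2 * i \<noteq> n" "y t \<noteq> 0"
      and per: "\<And>t. y (t mod int n) = y t" and ker: "\<And>t. y (t + int i) + y (t - int i) = 0"
      by blast
    define v where "v = vec n (\<lambda>a. y (int a))"
    have v: "v $ N t = y t" for t
      using N[of t] per by (simp add: v_def)
    have "v \<noteq> 0\<^sub>v n"
      using v[of t] N[of t] \<open>y t \<noteq> 0\<close> by auto
    moreover have "(\<Sum>b \<in> {N (int a + int i), N (int a - int i)}. v $ b) = 0" for a
      using N_coincide[of "int a"] \<open>2 * i \<noteq> n\<close> ker by (simp add: v)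
    ultimately show ?l
      unfolding singular_iff by (intro exI[of _ v]) (auto simp: v_def)
  qed
qed

theorem lemma12:
  fixes n i :: nat
  assumes "n \<ge> 3" and "1 \<le> i" and "i \<le> n div 2"
  shows "singular_graph (distance_graph (cycle_graph n) i) \<longleftrightarrow>
           4 dvd n \<and> gcd i (n div 2) dvd n div 4"
  unfolding singular_distance_graph_cycle_graph_iff[OF assms]
proof
  assume "2 * i \<noteq> n \<and> (\<exists>y :: int \<Rightarrow> real. (\<exists>t. y t \<noteq> 0) \<and> (\<forall>t. y (t mod int n) = y t) \<and>
      (\<forall>t. y (t + int i) + y (t - int i) = 0))"
  then obtain y :: "int \<Rightarrow> real" and t where "y t \<noteq> 0"
    and per: "\<And>t. y (t mod int n) = y t" and ker: "\<And>t. y (t + int i) + y (t - int i) = 0"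
    by blast
  have step: "y (t + 2 * int i) = - y t" for t
    using ker[of "t + int i"] by (simp add: algebra_simps eq_neg_iff_add_eq_0)
  have steps: "y (t + 2 * int i * int j) = (-1) ^ j * y t" for j
  proof (induction j)
    case (Suc j)
    then show ?case
      using step[of "t + 2 * int i * int j"] by (simp add: algebra_simps)
  qed simp
  \<comment> \<open>The order of \<open>2 * i\<close> modulo \<open>n\<close>: after
    \<open>j\<close> translations \<open>y\<close> returns to its value with sign
    \<open>(-1) ^ j\<close>.\<close>
  define j where "j = n div gcd n (2 * i)"
  have "2 * i * j = n * (2 * i div gcd n (2 * i))"
    unfolding j_def by (metis div_mult_swap dvd_div_mult gcd_dvd1 gcd_dvd2 mult.commute)
  then have "2 * int i * int j = int n * int (2 * i div gcd n (2 * i))"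
    by (metis of_nat_mult of_nat_numeral)
  then have "y (t + 2 * int i * int j) = y t"
    by (metis per mod_mult_self2)
  with steps[of j] \<open>y t \<noteq> 0\<close> have "even j"
    by (cases "even j") auto
  then obtain m where m: "n = gcd n (2 * i) * (2 * m)"
    by (auto simp: j_def elim!: evenE) (metis dvd_mult_div_cancel gcd_dvd1)
  then have "even n" by (metis dvd_mult dvd_triv_left)
  then obtain h where h: "n = 2 * h" by blast
  \<comment> \<open>Combined with \<open>m\<close>, this extracts the factor \<open>4\<close> of
    \<open>n\<close> and exhibits \<open>gcd i h\<close> as a divisor of
    \<open>n div 4\<close>.\<close>
  have "gcd n (2 * i) = 2 * gcd i h"
    by (simp add: h gcd_mult_distrib_nat gcd.commute)
  with m have n: "n = 4 * (gcd i h * m)" by simp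
  then have "n div 4 = gcd i h * m" by linarith
  moreover have "n div 2 = h" using h by linarith
  moreover have "4 dvd n" by (subst n) (rule dvd_triv_left)
  ultimately show "4 dvd n \<and> gcd i (n div 2) dvd n div 4"
    by simp
next
  assume r: "4 dvd n \<and> gcd i (n div 2) dvd n div 4"
  define g where "g = gcd i (n div 2)"
  obtain m where m: "n = 4 * g * m"
    using r by (auto simp: g_def elim!: dvdE)
  have "g > 0" "g dvd i" using assms by (auto simp: g_def)
  then obtain c where c: "i = g * c" by blast
  \<comment> \<open>Dividing \<open>i\<close> and \<open>n div 2\<close> by their gcd
    \<open>g\<close> leaves the coprime pair \<open>c\<close> and \<open>2 * m\<close>, so
    \<open>c\<close> is odd.\<close>
  have "n div 2 = g * (2 * m)"
    using m by simp
  then have "gcd (g * c) (g * (2 * m)) = g"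
    using c g_def by argo
  then have "g * gcd c (2 * m) = g"
    by (simp only: gcd_mult_distrib_nat)
  then have "coprime c (2 * m)"
    using \<open>g > 0\<close> by (simp add: coprime_iff_gcd_eq_1)
  then have "odd c" by auto
  define y :: "int \<Rightarrow> real" where "y t = cos (pi * of_int t / (2 * real g))" for t
  have period: "y (t + int n * k) = y t" for t k
  proof -
    \<comment> \<open>As \<open>n = 4 * g * m\<close>, shifting by \<open>n * k\<close> adds
      \<open>m * k\<close> full turns to the phase.\<close>
    have "pi * of_int (t + int n * k) / (2 * real g) =
        pi * of_int t / (2 * real g) + 2 * pi * of_int (int m * k)"
      using \<open>g > 0\<close> by (simp add: m field_simps)
    then show ?thesis
      unfolding y_def by (simp only: cos_add cos_int_2pin sin_int_2pin mult_1_right mult_zero_right diff_zero)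
  qed
  have "y (t mod int n) = y t" for t
    using period[of "t mod int n" "t div int n"] by simp
  moreover have "y (t + int i) + y (t - int i) = 0" for t
  proof -
    \<comment> \<open>The sum is \<open>2 * y t\<close> times the cosine of this phase, an odd
      multiple of \<open>pi / 2\<close>.\<close>
    have "pi * real i / (2 * real g) = real c * (pi / 2)"
      using \<open>g > 0\<close> by (simp add: c)
    moreover have "cos (real c * (pi / 2)) = 0"
      unfolding cos_zero_iff using \<open>odd c\<close> by blast
    ultimately have "cos (pi * real i / (2 * real g)) = 0"
      by (simp only:)
    then show ?thesis
      by (simp add: y_def distrib_left right_diff_distrib add_divide_distrib diff_divide_distrib
          cos_add cos_diff)
  qed
  moreover have "y 0 \<noteq> 0" by (simp add: y_def)
  moreover have "2 * i \<noteq> n"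
  proof
    assume "2 * i = n"
    then have "g * c = g * (2 * m)"
      using m c by linarith
    then have "c = 2 * m"
      using \<open>g > 0\<close> by (simp only: mult_cancel_left) simp
    then show False
      using \<open>odd c\<close> by simp
  qed
  ultimately show "2 * i \<noteq> n \<and> (\<exists>y :: int \<Rightarrow> real. (\<exists>t. y t \<noteq> 0) \<and> (\<forall>t. y (t mod int n) = y t) \<and>
      (\<forall>t. y (t + int i) + y (t - int i) = 0))"
    by blast
qed

end
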